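(* Let $\alpha\in[0,1)$ and suppose $S\in Map[\ell,k]$ is an optimal assignment map. Let $j\in\{1,\dots,\ell\}$ and $s\in\{1,\dots,k\}$. (i) If $\mathfrak{m}(\mathbf{b}_s)\ge n_j$ and $$y_j\in\Big\{z\in\mathbb{R}^m:\min_{i\ne s}\|z-x_i\|<\rho_\alpha(\mathfrak{m}(\mathbf{b}_s),n_j)\,\|z-x_s\|\Big\},$$ then $S(j)\ne s$. (ii) If $$y_j\in\Big\{z\in\mathbb{R}^m:\|z-x_s\|<\rho_\alpha(\mathfrak{m}(\mathbf{b}_i),n_j)\,\|z-x_i\|\ \text{ for every } i\ne s \text{ with } \mathfrak{m}(\mathbf{b}_i)\ge n_j\Big\},$$ then $S(j)=s$.
   Context: $X\subset\mathbb{R}^m$ is compact and convex, $\|\cdot\|$ is the Euclidean norm, $\mathbf{x}=\{x_1,\dots,x_k\}\subset X$ is a set of $k$ points, $\mathbf{b}=\sum_{j=1}^\ell n_j\delta_{y_j}$ with $y_j\in X$, $n_j>0$, $\sum_j n_j=1$. A minimum over the empty set is $+\infty$. The mass of an atomic measure $\mathbf{c}=\sum_i c_i\delta_{z_i}$ is $\mathfrak{m}(\mathbf{c})=\sum_i c_i$. For atomic measures $\mathbf{a},\mathbf{c}$ on $X$ of equal mass, a transport path from $\mathbf{a}$ to $\mathbf{c}$ is a weighted directed graph $G$ (without cycles) with finite vertex set $V(G)$ containing the atoms of $\mathbf{a}$ and $\mathbf{c}$, finite set $E(G)$ of directed edges which are line segments from $e^-$ to $e^+$, and weights $w:E(G)\to(0,\infty)$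 such that for all $v\in V(G)$, $\sum_{e^-=v}w(e)=\sum_{e^+=v}w(e)+\mathbf{a}(\{v\})-\mathbf{c}(\{v\})$. $\mathbf{M}_\alpha(G)=\sum_{e\in E(G)}w(e)^\alpha\,length(e)$ and $d_\alpha(\mathbf{a},\mathbf{c})$ is the minimum of $\mathbf{M}_\alpha(G)$ over all transport paths from $\mathbf{a}$ to $\mathbf{c}$ ($0$ for zero measures). $Map[\ell,k]$ is the set of functions $S:\{1,\dots,\ell\}\to\{1,\dots,k\}$. For such $S$, $\mathbf{a}_i=\big(\sum_{j\in S^{-1}(i)}n_j\big)\delta_{x_i}$, $\mathbf{b}_i=\sum_{j\in S^{-1}(i)}n_j\delta_{y_j}$, so $\mathfrak{m}(\mathbf{b}_i)=\sum_{j\in S^{-1}(i)}n_j$, and $\mathbf{E}_\alpha(S;\mathbf{x},\mathbf{b})=\sum_{i=1}^kd_\alpha(\mathbf{a}_i,\mathbf{b}_i)$. $S$ is an optimal assignment map if it minimizes $\mathbf{E}_\alpha(\cdot\,;\mathbf{x},\mathbf{b})$ over $Map[\ell,k]$. For $\alpha\in(0,1)$ and $\sigma\ge\epsilon>0$, $\rho_\alpha(\sigma,\epsilon)=\left(\frac{\sigma}{\epsilon}\right)^\alpha-\left(\frac{\sigma}{\epsilon}-1\right)^\alpha$; for $\alpha=0$, $\rho_0(\sigma,\epsilon)=0$ if $\sigma>\epsilon>0$ and $\rho_0(\sigma,\epsilon)=1$ if $\sigma=\epsilon>0$. *)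

theory Defs
  imports "HOL-Analysis.Analysis" "HOL-Library.Poly_Mapping" "HOL-Library.FuncSet"
begin

text \<open>
  A finitely atomic measure is a finitely supported function: \<open>lookup a v\<close> is the mass
  of \<open>{v}\<close>, \<open>keys a\<close> is the set of atoms and \<open>Poly_Mapping.single v r\<close> is \<open>r\<close> times the
  Dirac measure at \<open>v\<close>.
\<close>

type_synonym 'a atomic = "'a \<Rightarrow>\<^sub>0 real"

definition mass :: "'a atomic \<Rightarrow> real" where
  "mass c = (\<Sum>z\<in>Poly_Mapping.keys c. Poly_Mapping.lookup c z)"

text \<open>
  An edge \<open>(u, v)\<close> is the line segment directed from \<open>u\<close> to \<open>v\<close>.  Edges are determined by
  their end points, so there are no parallel edges.
\<close>

record 'a wgraph =
  verts :: "'a set"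
  edges :: "('a \<times> 'a) set"
  weight :: "'a \<times> 'a \<Rightarrow> real"

text \<open>
  The ambient space is \<open>X\<close>: vertices lie in \<open>X\<close>, hence so do the edges when \<open>X\<close> is convex.
  Absence of cycles is that of directed graphs; in particular there are no loops.
  The edge set is finite because the vertex set is.
\<close>

definition transport_path ::
  "'a set \<Rightarrow> 'a atomic \<Rightarrow> 'a atomic \<Rightarrow> 'a wgraph \<Rightarrow> bool" where
  "transport_path X a c G \<longleftrightarrow>
     finite (verts G) \<and> verts G \<subseteq> X \<and>
     Poly_Mapping.keys a \<union> Poly_Mapping.keys c \<subseteq> verts G \<and>
     edges G \<subseteq> verts G \<times> verts G \<and> acyclic (edges G) \<and>
     (\<forall>e\<in>edges G. 0 < weight G e) \<and>
     (\<forall>v\<in>verts G. (\<Sum>e | e \<in> edges G \<and> fst e = v. weight G e) =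
        (\<Sum>e | e \<in> edges G \<and> snd e = v. weight G e)
          + Poly_Mapping.lookup a v - Poly_Mapping.lookup c v)"

text \<open>For \<open>\<alpha> = 0\<close> note that \<open>w powr 0 = 1\<close> for \<open>w > 0\<close>.\<close>

definition M_cost :: "real \<Rightarrow> 'a::metric_space wgraph \<Rightarrow> real" where
  "M_cost \<alpha> G = (\<Sum>e\<in>edges G. weight G e powr \<alpha> * dist (fst e) (snd e))"

text \<open>
  The minimum is taken as an infimum, with which it agrees whenever it is attained.
  The costs are nonnegative, and for positive measures of equal mass on a convex set
  the set of transport paths is nonempty.  For zero measures the graph without edges gives
  the value \<open>0\<close>.
\<close>

definition d_cost ::
  "real \<Rightarrow> 'a::metric_space set \<Rightarrow> 'a atomic \<Rightarrow> 'a atomic \<Rightarrow> real" where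
  "d_cost \<alpha> X a c = (INF G\<in>{G. transport_path X a c G}. M_cost \<alpha> G)"

definition Maps :: "nat \<Rightarrow> nat \<Rightarrow> (nat \<Rightarrow> nat) set" where
  "Maps l k = {1..l} \<rightarrow>\<^sub>E {1..k}"

definition fibre :: "nat \<Rightarrow> (nat \<Rightarrow> nat) \<Rightarrow> nat \<Rightarrow> nat set" where
  "fibre l S i = {j \<in> {1..l}. S j = i}"

definition a_part ::
  "nat \<Rightarrow> (nat \<Rightarrow> 'a) \<Rightarrow> (nat \<Rightarrow> real) \<Rightarrow> (nat \<Rightarrow> nat) \<Rightarrow> nat \<Rightarrow> 'a atomic" where
  "a_part l x n S i = Poly_Mapping.single (x i) (\<Sum>j\<in>fibre l S i. n j)"

definition b_part ::
  "nat \<Rightarrow> (nat \<Rightarrow> 'a) \<Rightarrow> (nat \<Rightarrow> real) \<Rightarrow> (nat \<Rightarrow> nat) \<Rightarrow> nat \<Rightarrow> 'a atomic" where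
  "b_part l y n S i = (\<Sum>j\<in>fibre l S i. Poly_Mapping.single (y j) (n j))"

definition E_cost ::
  "real \<Rightarrow> 'a::metric_space set \<Rightarrow> nat \<Rightarrow> nat \<Rightarrow> (nat \<Rightarrow> 'a) \<Rightarrow> (nat \<Rightarrow> 'a) \<Rightarrow> (nat \<Rightarrow> real)
     \<Rightarrow> (nat \<Rightarrow> nat) \<Rightarrow> real" where
  "E_cost \<alpha> X k l x y n S =
     (\<Sum>i\<in>{1..k}. d_cost \<alpha> X (a_part l x n S i) (b_part l y n S i))"

definition optimal_assignment ::
  "real \<Rightarrow> 'a::metric_space set \<Rightarrow> nat \<Rightarrow> nat \<Rightarrow> (nat \<Rightarrow> 'a) \<Rightarrow> (nat \<Rightarrow> 'a) \<Rightarrow> (nat \<Rightarrow> real)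
     \<Rightarrow> (nat \<Rightarrow> nat) \<Rightarrow> bool" where
  "optimal_assignment \<alpha> X k l x y n S \<longleftrightarrow>
     S \<in> Maps l k \<and> (\<forall>T\<in>Maps l k. E_cost \<alpha> X k l x y n S \<le> E_cost \<alpha> X k l x y n T)"

text \<open>Only meaningful for \<open>\<sigma> \<ge> \<epsilon> > 0\<close>.\<close>

definition rho :: "real \<Rightarrow> real \<Rightarrow> real \<Rightarrow> real" where
  "rho \<alpha> \<sigma> \<epsilon> =
     (if \<alpha> = 0 then (if \<sigma> > \<epsilon> then 0 else 1)
      else (\<sigma> / \<epsilon>) powr \<alpha> - (\<sigma> / \<epsilon> - 1) powr \<alpha>)"

end

theory Submission
  imports Defs
begin

text \<open>
  If \<open>S j = s\<close> and \<open>r \<noteq> s\<close>, reassign \<open>y j\<close> to \<open>x r\<close>.  Joining \<open>x r\<close> directly to \<open>y j\<close> costs at most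
  \<open>n j powr \<alpha> * dist (x r) (y j)\<close> more, so by optimality it is enough that taking the mass
  \<open>n j\<close> away from the transport path from \<open>x s\<close> saves at least \<open>(m powr \<alpha> - (m - n j) powr \<alpha>) * dist (x s) (y j)\<close>,
  where \<open>m\<close> is the mass of \<open>b_part l y n S s\<close>.  Cancel the flow along a directed path from \<open>x s\<close> to
  \<open>y j\<close> until \<open>n j\<close> has been removed or an edge of the path is exhausted, and in the second case
  continue with the smaller graph.  Edge weights never exceed the mass of the source, so by
  concavity of \<open>t powr \<alpha>\<close> each round saves at least the decrease of (source mass) \<open>powr \<alpha>\<close> times the
  distance; these decreases telescope.
\<close>

section \<open>Concavity of powers\<close>

text \<open>The sign of the second derivative gives concavity only on the open half-line. At the
  endpoint 0 the inequality reduces to \<open>u \<le> u powr p\<close>.\<close>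

lemma powr_concave_on:
  fixes p :: real
  assumes "0 < p" "p \<le> 1"
  shows "concave_on {0..} (\<lambda>t. t powr p)"
proof (rule concave_on_linorderI)
  fix u a b :: real
  assume u: "0 < u" "u < 1" and ab: "a \<in> {0..}" "b \<in> {0..}" "a < b"
  have pos: "concave_on {0<..} (\<lambda>t. t powr p)"
  proof (rule f''_le0_imp_concave)
    show "((\<lambda>t. t powr p) has_real_derivative p * t powr (p - 1)) (at t)" if "t \<in> {0<..}" for t
      using that by (auto intro!: derivative_eq_intros)
    show "((\<lambda>t. p * t powr (p - 1)) has_real_derivative p * ((p - 1) * t powr (p - 2))) (at t)"
      if "t \<in> {0<..}" for t
      using that by (auto intro!: derivative_eq_intros)
    show "p * ((p - 1) * t powr (p - 2)) \<le> 0" for t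
      using assms by (intro mult_nonneg_nonpos mult_nonpos_nonneg) auto
  qed auto
  show "(1 - u) * a powr p + u * b powr p \<le> ((1 - u) *\<^sub>R a + u *\<^sub>R b) powr p"
  proof (cases "a = 0")
    case True
    have "u powr 1 \<le> u powr p" using u assms by (intro powr_mono') auto
    then have "u * b powr p \<le> u powr p * b powr p" using u by (intro mult_right_mono) auto
    then show ?thesis using True u ab assms by (simp add: powr_mult)
  next
    case False
    then show ?thesis using concave_onD[OF pos, of u a b] u ab by simp
  qed
qed auto

text \<open>\<open>w\<close> and \<open>m - t\<close> lie between \<open>w - t\<close> and
  \<open>m\<close> and have the same sum as these two, so by concavity a step of length
  \<open>t\<close> drops less when it starts further right.\<close>

lemma powr_diff_antimono:
  fixes p :: real
  assumes p: "0 \<le> p" "p \<le> 1" and t: "0 \<le> t" "t \<le> w" and wm: "w \<le> m"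
  shows "m powr p - (m - t) powr p \<le> w powr p - (w - t) powr p"
proof (cases "p = 0 \<or> t = 0 \<or> w = m")
  \<comment> \<open>For \<open>p = 0\<close> the convention \<open>0 powr 0 = 0\<close> enters: the
    drop is 1 exactly when a positive quantity is exhausted.\<close>
  case True
  then show ?thesis using t wm by auto
next
  case False
  then have p0: "0 < p" and d: "0 < m - (w - t)" using p t wm by auto
  note conc = concave_onD[OF powr_concave_on[OF p0 p(2)], simplified]
  define D where "D = m - (w - t)"
  \<comment> \<open>\<open>q\<close> is the weight of \<open>m\<close> in the convex combination
    that gives \<open>w\<close>; the mirrored combination gives \<open>m - t\<close>.\<close>
  define q where "q = t / D"
  have D: "D > 0" using d D_def by simp
  have q: "0 \<le> q" "q \<le> 1" using t wm D unfolding q_def D_def by (auto simp: field_simps)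
  have qD: "q * D = t" using D q_def by simp
  have e1: "(1 - q) * (w - t) + q * m = w" and e2: "q * (w - t) + (1 - q) * m = m - t"
    using qD by (auto simp: D_def algebra_simps)
  have "(1 - q) * (w - t) powr p + q * m powr p \<le> w powr p"
    using conc[of q "w - t" m] q t wm e1 by simp
  moreover have "q * (w - t) powr p + (1 - q) * m powr p \<le> (m - t) powr p"
    using conc[of "1 - q" "w - t" m] q t wm e2 by simp
  ultimately show ?thesis by (simp add: algebra_simps)
qed

lemma powr_add_le:
  fixes p :: real
  assumes "0 \<le> p" "p \<le> 1" "0 \<le> s" "0 \<le> t"
  shows "(s + t) powr p \<le> s powr p + t powr p"
  using powr_diff_antimono[of p t t "s + t"] assms by simp

section \<open>Flow through cuts and the structure of single-source transport paths\<close>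

lemma transport_pathD:
  assumes "transport_path X a c G"
  shows "finite (verts G)" "verts G \<subseteq> X"
    "Poly_Mapping.keys a \<subseteq> verts G" "Poly_Mapping.keys c \<subseteq> verts G"
    "edges G \<subseteq> verts G \<times> verts G" "finite (edges G)" "acyclic (edges G)"
    "\<And>e. e \<in> edges G \<Longrightarrow> 0 < weight G e"
    "\<And>v. v \<in> verts G \<Longrightarrow> (\<Sum>e | e \<in> edges G \<and> fst e = v. weight G e) =
        (\<Sum>e | e \<in> edges G \<and> snd e = v. weight G e)
          + Poly_Mapping.lookup a v - Poly_Mapping.lookup c v"
  using assms finite_subset[of "edges G" "verts G \<times> verts G"]
  unfolding transport_path_def by auto

text \<open>Summing the balance equation over \<open>A\<close> cancels the edges inside
  \<open>A\<close>. No edge enters \<open>A\<close>, so only the outflow remains. It is applied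
  below to sets of ancestors.\<close>

lemma transport_path_cut:
  assumes G: "transport_path X a c G" and A: "A \<subseteq> verts G"
    and closed: "\<And>u v. (u, v) \<in> edges G \<Longrightarrow> v \<in> A \<Longrightarrow> u \<in> A"
  shows "(\<Sum>e | e \<in> edges G \<and> fst e \<in> A \<and> snd e \<notin> A. weight G e) =
    (\<Sum>v\<in>A. Poly_Mapping.lookup a v - Poly_Mapping.lookup c v)"
proof -
  note G = transport_pathD[OF G]
  let ?E = "edges G" and ?w = "weight G"
  have finA: "finite A" using A G(1) finite_subset by blast
  \<comment> \<open>The endpoint map \<open>g\<close> is arbitrary so that the identity serves for
    both \<open>fst\<close> and \<open>snd\<close>.\<close>
  have group: "(\<Sum>v\<in>A. \<Sum>e | e \<in> ?E \<and> g e = v. ?w e) = (\<Sum>e | e \<in> ?E \<and> g e \<in> A. ?w e)"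
    for g :: "'a \<times> 'a \<Rightarrow> 'a"
  proof -
    have "(\<Sum>v\<in>A. \<Sum>e | e \<in> {e \<in> ?E. g e \<in> A} \<and> g e = v. ?w e) = (\<Sum>e\<in>{e \<in> ?E. g e \<in> A}. ?w e)"
      by (rule sum.group) (use finA G(6) in auto)
    moreover have "{e. e \<in> {e \<in> ?E. g e \<in> A} \<and> g e = v} = {e. e \<in> ?E \<and> g e = v}" if "v \<in> A" for v
      using that by auto
    ultimately show ?thesis by simp
  qed
  have "(\<Sum>e | e \<in> ?E \<and> fst e \<in> A. ?w e) =
      (\<Sum>e | e \<in> ?E \<and> snd e \<in> A. ?w e) + (\<Sum>v\<in>A. Poly_Mapping.lookup a v - Poly_Mapping.lookup c v)"
    unfolding group[symmetric] sum.distrib[symmetric]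
    by (rule sum.cong) (use G(9) A in auto)
  moreover have "{e. e \<in> ?E \<and> fst e \<in> A} =
      {e. e \<in> ?E \<and> snd e \<in> A} \<union> {e. e \<in> ?E \<and> fst e \<in> A \<and> snd e \<notin> A}"
    using closed by auto
  moreover have "(\<Sum>e\<in>{e. e \<in> ?E \<and> snd e \<in> A} \<union> {e. e \<in> ?E \<and> fst e \<in> A \<and> snd e \<notin> A}. ?w e) =
      (\<Sum>e | e \<in> ?E \<and> snd e \<in> A. ?w e) + (\<Sum>e | e \<in> ?E \<and> fst e \<in> A \<and> snd e \<notin> A. ?w e)"
    by (rule sum.union_disjoint) (use G(6) in auto)
  ultimately show ?thesis by simp
qed

lemma edges_predecessors_subset_verts:
  assumes "transport_path X a c G" "v \<in> verts G"
  shows "{u. (u, v) \<in> (edges G)\<^sup>*} \<subseteq> verts G"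
  using transport_pathD(5)[OF assms(1)] assms(2)
  by (auto elim: converse_rtranclE)

text \<open>Cut at the ancestors of the tail of \<open>e\<close>. By acyclicity \<open>e\<close>
  leaves this set, so its weight is one term of an outflow that the supply \<open>m\<close>
  bounds.\<close>

lemma single_source_weight_le:
  assumes G: "transport_path X (Poly_Mapping.single x m) c G"
    and c: "\<And>v. 0 \<le> Poly_Mapping.lookup c v" and m: "0 \<le> m"
    and e: "e \<in> edges G"
  shows "weight G e \<le> m"
proof -
  note G' = transport_pathD[OF G]
  define A where "A = {u. (u, fst e) \<in> (edges G)\<^sup>*}"
  have sub: "A \<subseteq> verts G"
    unfolding A_def by (rule edges_predecessors_subset_verts[OF G]) (use e G'(5) in auto)
  have fA: "finite A" using sub G'(1) finite_subset by blast
  have e_out: "e \<in> {e. e \<in> edges G \<and> fst e \<in> A \<and> snd e \<notin> A}"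
    using e G'(7) unfolding A_def acyclic_def
    by (cases e) (auto dest: rtrancl_into_trancl2)
  have "weight G e \<le> (\<Sum>e | e \<in> edges G \<and> fst e \<in> A \<and> snd e \<notin> A. weight G e)"
    by (rule member_le_sum) (use e_out G'(6,8) less_imp_le in auto)
  also have "\<dots> = (\<Sum>v\<in>A. Poly_Mapping.lookup (Poly_Mapping.single x m) v - Poly_Mapping.lookup c v)"
    by (rule transport_path_cut[OF G sub]) (auto simp: A_def intro: converse_rtrancl_into_rtrancl)
  also have "\<dots> \<le> (\<Sum>v\<in>A. Poly_Mapping.lookup (Poly_Mapping.single x m) v)"
    by (rule sum_mono) (use c in auto)
  also have "\<dots> \<le> m"
    using fA m by (simp add: lookup_single when_def)
  finally show ?thesis .
qed

text \<open>Otherwise the ancestors of \<open>y\<close> would have no supply but positive demand,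
  hence a negative outflow.\<close>

lemma single_source_reaches_atom:
  assumes G: "transport_path X (Poly_Mapping.single x m) c G"
    and c: "\<And>v. 0 \<le> Poly_Mapping.lookup c v" and y: "0 < Poly_Mapping.lookup c y"
  shows "(x, y) \<in> (edges G)\<^sup>*"
proof (rule ccontr)
  assume no: "(x, y) \<notin> (edges G)\<^sup>*"
  note G' = transport_pathD[OF G]
  define A where "A = {u. (u, y) \<in> (edges G)\<^sup>*}"
  have yV: "y \<in> verts G" using y G'(4) by (auto simp: in_keys_iff)
  have sub: "A \<subseteq> verts G"
    unfolding A_def by (rule edges_predecessors_subset_verts[OF G yV])
  have fA: "finite A" using sub G'(1) finite_subset by blast
  have "0 \<le> (\<Sum>e | e \<in> edges G \<and> fst e \<in> A \<and> snd e \<notin> A. weight G e)"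
    by (rule sum_nonneg) (use G'(8) less_imp_le in auto)
  also have "\<dots> = (\<Sum>v\<in>A. Poly_Mapping.lookup (Poly_Mapping.single x m) v - Poly_Mapping.lookup c v)"
    by (rule transport_path_cut[OF G sub]) (auto simp: A_def intro: converse_rtrancl_into_rtrancl)
  also have "\<dots> = - (\<Sum>v\<in>A. Poly_Mapping.lookup c v)"
    using no by (auto simp: A_def lookup_single when_def sum_negf[symmetric] intro!: sum.cong)
  also have "\<dots> \<le> - Poly_Mapping.lookup c y"
    using member_le_sum[of y A "Poly_Mapping.lookup c"] fA c by (auto simp: A_def)
  finally show False using y by simp
qed

text \<open>The proper ancestors of \<open>x\<close> have no supply, so no flow can leave them, yet
  \<open>(u, x)\<close> would. This keeps the graph acyclic when an edge starting at
  \<open>x\<close> is added.\<close>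

lemma single_source_no_edge_into_source:
  assumes G: "transport_path X (Poly_Mapping.single x m) c G"
    and c: "\<And>v. 0 \<le> Poly_Mapping.lookup c v"
  shows "(u, x) \<notin> edges G"
proof
  assume u: "(u, x) \<in> edges G"
  note G' = transport_pathD[OF G]
  define A where "A = {v. (v, x) \<in> (edges G)\<^sup>+}"
  have xA: "x \<notin> A" using G'(7) by (auto simp: A_def acyclic_def)
  have sub: "A \<subseteq> verts G"
    using G'(5) by (auto simp: A_def elim: converse_tranclE)
  have "0 < weight G (u, x)" using G'(8) u by blast
  also have "\<dots> \<le> (\<Sum>e | e \<in> edges G \<and> fst e \<in> A \<and> snd e \<notin> A. weight G e)"
    by (rule member_le_sum) (use u xA G'(6,8) less_imp_le in \<open>auto simp: A_def\<close>)
  also have "\<dots> = (\<Sum>v\<in>A. Poly_Mapping.lookup (Poly_Mapping.single x m) v - Poly_Mapping.lookup c v)"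
    by (rule transport_path_cut[OF G sub]) (auto simp: A_def intro: trancl_into_trancl2)
  also have "\<dots> \<le> 0"
    by (rule sum_nonpos) (use xA c in \<open>auto simp: lookup_single when_def\<close>)
  finally show False by simp
qed

section \<open>Taking mass away along a directed path\<close>

text \<open>A path is kept as a set of edges; the degree identity says that its indicator is a unit
  flow from \<open>u\<close> to \<open>v\<close>. That \<open>v\<close> is reachable from each
  \<open>snd e\<close> is carried along for the induction: with acyclicity it shows that the next
  edge is new.\<close>

lemma acyclic_path_edges:
  fixes E :: "('a::metric_space \<times> 'a) set"
  assumes "(u, v) \<in> E\<^sup>*" and "acyclic E"
  shows "\<exists>P. finite P \<and> P \<subseteq> E \<and> (\<forall>e\<in>P. (snd e, v) \<in> E\<^sup>*) \<and>
    (\<forall>z. real (card {e \<in> P. fst e = z}) + of_bool (z = v) =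
         real (card {e \<in> P. snd e = z}) + of_bool (z = u)) \<and>
    dist u v \<le> (\<Sum>e\<in>P. dist (fst e) (snd e))"
  using assms(1)
proof (induction rule: rtrancl_induct)
  case base
  show ?case by (rule exI[of _ "{}"]) auto
next
  case (step v w)
  then obtain P where P: "finite P" "P \<subseteq> E" "\<And>e. e \<in> P \<Longrightarrow> (snd e, v) \<in> E\<^sup>*"
    and bal: "\<And>z. real (card {e \<in> P. fst e = z}) + of_bool (z = v) =
         real (card {e \<in> P. snd e = z}) + of_bool (z = u)"
    and len: "dist u v \<le> (\<Sum>e\<in>P. dist (fst e) (snd e))" by blast
  have new: "(v, w) \<notin> P"
    using P(3)[of "(v, w)"] step(2) assms(2) by (auto simp: acyclic_def dest: rtrancl_into_trancl2)
  have card_ins: "real (card {e \<in> insert (v, w) P. g e = z}) =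
      real (card {e \<in> P. g e = z}) + of_bool (g (v, w) = z)" for g :: "'a \<times> 'a \<Rightarrow> 'a" and z
  proof (cases "g (v, w) = z")
    case True
    then have "{e \<in> insert (v, w) P. g e = z} = insert (v, w) {e \<in> P. g e = z}" by auto
    then show ?thesis using True new P(1) by simp
  next
    case False
    then have "{e \<in> insert (v, w) P. g e = z} = {e \<in> P. g e = z}" by auto
    then show ?thesis using False by simp
  qed
  show ?case
  proof (intro exI[of _ "insert (v, w) P"] conjI allI ballI)
    show "(snd e, w) \<in> E\<^sup>*" if "e \<in> insert (v, w) P" for e
      using that P(3)[of e] step(2) by (auto intro: rtrancl_into_rtrancl)
    show "real (card {e \<in> insert (v, w) P. fst e = z}) + of_bool (z = w) =
         real (card {e \<in> insert (v, w) P. snd e = z}) + of_bool (z = u)" for z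
      unfolding card_ins using bal[of z] by (auto simp: of_bool_def split: if_splits)
    show "dist u w \<le> (\<Sum>e\<in>insert (v, w) P. dist (fst e) (snd e))"
      using new P(1) len dist_triangle[of u w v] by simp
  qed (use P step in auto)
qed

text \<open>By the degree identity, subtracting \<open>t\<close> times the indicator of
  \<open>P\<close> changes the balance only at \<open>u\<close> and \<open>v\<close>. Exhausted
  edges are deleted because weights must stay positive.\<close>

lemma transport_path_push:
  assumes G: "transport_path X a c G" and P: "P \<subseteq> edges G"
    and bal: "\<And>z. real (card {e \<in> P. fst e = z}) + of_bool (z = v) =
         real (card {e \<in> P. snd e = z}) + of_bool (z = u)"
    and uv: "u \<in> verts G" "v \<in> verts G"
    and t: "0 \<le> t" "\<And>e. e \<in> P \<Longrightarrow> t \<le> weight G e"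
    and w': "w' = (\<lambda>e. weight G e - (if e \<in> P then t else 0))"
  shows "transport_path X (a - Poly_Mapping.single u t) (c - Poly_Mapping.single v t)
    \<lparr>verts = verts G, edges = {e \<in> edges G. 0 < w' e}, weight = w'\<rparr>"
proof -
  note G' = transport_pathD[OF G]
  let ?E = "edges G"
  have w'0: "0 \<le> w' e" if "e \<in> ?E" for e
    using t(2) G'(8)[OF that] unfolding w' by (auto split: if_splits)
  \<comment> \<open>Deleted edges have \<open>w' e = 0\<close> and may be put back into the sum;
    then \<open>t\<close> is subtracted once per edge of \<open>P\<close> at
    \<open>z\<close>.\<close>
  have sums: "(\<Sum>e | e \<in> {e \<in> ?E. 0 < w' e} \<and> g e = z. w' e) =
      (\<Sum>e | e \<in> ?E \<and> g e = z. weight G e) - t * card {e \<in> P. g e = z}"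
    for g :: "'a \<times> 'a \<Rightarrow> 'a" and z
  proof -
    have "(\<Sum>e | e \<in> {e \<in> ?E. 0 < w' e} \<and> g e = z. w' e) = (\<Sum>e | e \<in> ?E \<and> g e = z. w' e)"
      by (rule sum.mono_neutral_left) (use G'(6) w'0 in \<open>auto simp: less_le\<close>)
    also have "\<dots> = (\<Sum>e | e \<in> ?E \<and> g e = z. weight G e) -
        (\<Sum>e | e \<in> ?E \<and> g e = z. if e \<in> P then t else 0)"
      unfolding w' by (rule sum_subtractf)
    also have "(\<Sum>e | e \<in> ?E \<and> g e = z. if e \<in> P then t else 0) = (\<Sum>e | e \<in> P \<and> g e = z. t)"
      by (rule sum.mono_neutral_cong_right) (use G'(6) P in auto)
    finally show ?thesis by simp
  qed
  have keys: "Poly_Mapping.keys (d - Poly_Mapping.single z t) \<subseteq> verts G"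
    if "Poly_Mapping.keys d \<subseteq> verts G" "z \<in> verts G" for d z
    using that keys_diff[of d "Poly_Mapping.single z t"] by (auto split: if_splits)
  show ?thesis
    unfolding transport_path_def
  proof (simp only: wgraph.simps sums, intro conjI ballI)
    show "acyclic {e \<in> ?E. 0 < w' e}"
      by (rule acyclic_subset[OF G'(7)]) auto
    show "(\<Sum>e | e \<in> ?E \<and> fst e = z. weight G e) - t * card {e \<in> P. fst e = z} =
        (\<Sum>e | e \<in> ?E \<and> snd e = z. weight G e) - t * card {e \<in> P. snd e = z}
        + Poly_Mapping.lookup (a - Poly_Mapping.single u t) z
        - Poly_Mapping.lookup (c - Poly_Mapping.single v t) z" if z: "z \<in> verts G" for z
    proof -
      have "t * card {e \<in> P. fst e = z} + t * of_bool (z = v) =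
          t * card {e \<in> P. snd e = z} + t * of_bool (z = u)"
        using arg_cong[OF bal[of z], of "(*) t"] by (simp add: distrib_left)
      then show ?thesis
        using G'(9)[OF z] by (auto simp: lookup_minus lookup_single when_def split: if_splits)
    qed
  qed (use G' keys uv in auto)
qed

text \<open>Induction on the number of edges, since a round that does not finish deletes one.
  \<open>m\<close>, \<open>c\<close> and \<open>d\<close> vary because the next round starts from
  what is left.\<close>

lemma transport_path_remove_atom:
  fixes G :: "'a::metric_space wgraph"
  assumes p: "0 \<le> p" "p \<le> 1"
    and "transport_path X (Poly_Mapping.single x m) c G"
    and "\<And>v. 0 \<le> Poly_Mapping.lookup c v" and "0 \<le> d" "d \<le> Poly_Mapping.lookup c y" "d \<le> m"
  shows "\<exists>G'. transport_path X (Poly_Mapping.single x (m - d)) (c - Poly_Mapping.single y d) G' \<and>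
    M_cost p G' + (m powr p - (m - d) powr p) * dist x y \<le> M_cost p G"
  using assms(3-)
proof (induction "card (edges G)" arbitrary: G m c d rule: less_induct)
  case less
  note G = less.prems(1) and c = less.prems(2) and d = less.prems(3-5)
  note G' = transport_pathD[OF G]
  let ?w = "weight G"
  show ?case
  proof (cases "d = 0")
    case True
    then show ?thesis using G by (intro exI[of _ G]) simp
  next
    case False
    then have dpos: "0 < d" using d by simp
    then have mpos: "0 < m" using d by simp
    have xV: "x \<in> verts G" using G'(3) mpos by simp
    have yV: "y \<in> verts G" using G'(4) dpos d by (auto simp: in_keys_iff)
    have xy: "(x, y) \<in> (edges G)\<^sup>*"
      using single_source_reaches_atom[OF G c] dpos d by simp
    obtain P where P: "finite P" "P \<subseteq> edges G"
      and bal: "\<And>z. real (card {e \<in> P. fst e = z}) + of_bool (z = y) =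
           real (card {e \<in> P. snd e = z}) + of_bool (z = x)"
      and len: "dist x y \<le> (\<Sum>e\<in>P. dist (fst e) (snd e))"
      using acyclic_path_edges[OF xy G'(7)] by blast
    \<comment> \<open>The largest amount up to \<open>d\<close> whose removal leaves no edge of the
      path with negative weight.\<close>
    define t where "t = Min (insert d (?w ` P))"
    have t_le: "t \<le> d" "\<And>e. e \<in> P \<Longrightarrow> t \<le> ?w e"
      using P(1) unfolding t_def by auto
    have t_mem: "t \<in> insert d (?w ` P)" unfolding t_def using P(1) by (intro Min_in) auto
    have tpos: "0 < t" using t_mem dpos G'(8) P(2) by auto
    define w' where "w' = (\<lambda>e. ?w e - (if e \<in> P then t else 0))"
    define H where "H = \<lparr>verts = verts G, edges = {e \<in> edges G. 0 < w' e}, weight = w'\<rparr>"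
    define c' where "c' = c - Poly_Mapping.single y t"
    have H: "transport_path X (Poly_Mapping.single x (m - t)) c' H"
      using transport_path_push[OF G P(2) bal xV yV _ _ w'_def] tpos t_le
      by (simp add: H_def c'_def single_diff)
    have c'0: "0 \<le> Poly_Mapping.lookup c' v" for v
      using c[of v] d t_le(1) by (auto simp: c'_def lookup_minus lookup_single when_def)
    \<comment> \<open>Each weight is at most \<open>m\<close>, so the drop on an edge is at least
      the drop of the source mass.\<close>
    have drop: "(m powr p - (m - t) powr p) * dist (fst e) (snd e) \<le>
        (?w e powr p - w' e powr p) * dist (fst e) (snd e)" if "e \<in> P" for e
      using that P(2) t_le(2)[OF that] tpos single_source_weight_le[OF G c, of e] mpos
      by (auto simp: w'_def intro!: mult_right_mono powr_diff_antimono p)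
    \<comment> \<open>Deleted edges cost nothing even for \<open>p = 0\<close>, because
      \<open>0 powr p = 0\<close>.\<close>
    have "M_cost p H = (\<Sum>e\<in>edges G. w' e powr p * dist (fst e) (snd e))"
      unfolding M_cost_def H_def wgraph.simps
      by (rule sum.mono_neutral_left)
        (use G'(6,8) t_le(2) in \<open>auto simp: w'_def not_less intro: antisym\<close>)
    also have "\<dots> = M_cost p G -
        (\<Sum>e\<in>edges G. (?w e powr p - w' e powr p) * dist (fst e) (snd e))"
      by (simp add: M_cost_def sum_subtractf left_diff_distrib)
    also have "(\<Sum>e\<in>edges G. (?w e powr p - w' e powr p) * dist (fst e) (snd e)) =
        (\<Sum>e\<in>P. (?w e powr p - w' e powr p) * dist (fst e) (snd e))"
      by (rule sum.mono_neutral_right) (use G'(6) P in \<open>auto simp: w'_def\<close>)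
    finally have M_H: "M_cost p H = M_cost p G -
        (\<Sum>e\<in>P. (?w e powr p - w' e powr p) * dist (fst e) (snd e))" .
    have cost: "M_cost p H + (m powr p - (m - t) powr p) * dist x y \<le> M_cost p G"
    proof -
      have "(m powr p - (m - t) powr p) * dist x y \<le>
          (m powr p - (m - t) powr p) * (\<Sum>e\<in>P. dist (fst e) (snd e))"
        using len tpos t_le(1) d(3) p by (intro mult_left_mono) (auto intro!: powr_mono2)
      also have "\<dots> \<le> (\<Sum>e\<in>P. (?w e powr p - w' e powr p) * dist (fst e) (snd e))"
        unfolding sum_distrib_left by (rule sum_mono) (rule drop)
      finally show ?thesis using M_H by simp
    qed
    show ?thesis
    proof (cases "t = d")
      case True
      then show ?thesis using H cost by (auto simp: c'_def)
    next
      case False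
      \<comment> \<open>As \<open>t\<close> is not \<open>d\<close>, the minimum is the weight of an
        edge of the path, and that edge is exhausted.\<close>
      then obtain e where "e \<in> P" "t = ?w e" using t_mem by auto
      then have "e \<in> edges G" "e \<notin> edges H" using P(2) by (auto simp: H_def w'_def)
      then have "card (edges H) < card (edges G)"
        using G'(6) by (intro psubset_card_mono) (auto simp: H_def)
      from less.hyps[OF this H c'0, of "d - t"] obtain G'' where
        G'': "transport_path X (Poly_Mapping.single x (m - t - (d - t)))
            (c' - Poly_Mapping.single y (d - t)) G''"
          "M_cost p G'' + ((m - t) powr p - (m - t - (d - t)) powr p) * dist x y \<le> M_cost p H"
        using t_le(1) d by (auto simp: c'_def lookup_minus)
      have c'_eq: "c' - Poly_Mapping.single y (d - t) = c - Poly_Mapping.single y d"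
        by (simp add: c'_def single_diff)
      \<comment> \<open>The drops from \<open>m\<close> to \<open>m - t\<close> and from
        \<open>m - t\<close> to \<open>m - d\<close> telescope.\<close>
      then show ?thesis
        using G'' cost unfolding c'_eq by (intro exI[of _ G'']) (simp add: left_diff_distrib)
    qed
  qed
qed

section \<open>Adding an atom to a transport path\<close>

text \<open>At a new vertex all terms of the balance vanish. This makes \<open>x\<close> and
  \<open>y\<close> available as endpoints, which they need not be beforehand, for instance for zero
  measures.\<close>

lemma transport_path_add_verts:
  assumes G: "transport_path X a c G" and V: "finite V" "V \<subseteq> X"
  shows "transport_path X a c (G\<lparr>verts := verts G \<union> V\<rparr>)"
proof -
  note G' = transport_pathD[OF G]
  have "(\<Sum>e | e \<in> edges G \<and> fst e = v. weight G e) =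
        (\<Sum>e | e \<in> edges G \<and> snd e = v. weight G e)
          + Poly_Mapping.lookup a v - Poly_Mapping.lookup c v" for v
  proof (cases "v \<in> verts G")
    case False
    then have no_edges: "{e. e \<in> edges G \<and> fst e = v} = {}" "{e. e \<in> edges G \<and> snd e = v} = {}"
      and "v \<notin> Poly_Mapping.keys a" "v \<notin> Poly_Mapping.keys c"
      using G'(3-5) by auto
    then show ?thesis unfolding no_edges by (simp add: in_keys_iff)
  qed (rule G'(9))
  then show ?thesis
    using G' V unfolding transport_path_def by auto
qed

text \<open>The mass \<open>d\<close> is sent along the segment from \<open>x\<close> to
  \<open>y\<close>. There are no parallel edges, so an existing edge \<open>(x, y)\<close> gets
  heavier, and subadditivity of powers bounds its cost. If \<open>x = y\<close>, the added masses
  cancel.\<close>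

lemma transport_path_add_atom:
  fixes G0 :: "'a::metric_space wgraph"
  assumes p: "0 \<le> p" "p \<le> 1"
    and G0: "transport_path X (Poly_Mapping.single x m) c G0"
    and c: "\<And>v. 0 \<le> Poly_Mapping.lookup c v" and d: "0 < d" and xy: "x \<in> X" "y \<in> X"
  shows "\<exists>G'. transport_path X (Poly_Mapping.single x (m + d)) (c + Poly_Mapping.single y d) G' \<and>
    M_cost p G' \<le> M_cost p G0 + d powr p * dist x y"
proof -
  define G where "G = G0\<lparr>verts := verts G0 \<union> {x, y}\<rparr>"
  have G: "transport_path X (Poly_Mapping.single x m) c G"
    unfolding G_def by (rule transport_path_add_verts[OF G0]) (use xy in auto)
  have M: "M_cost p G = M_cost p G0" by (simp add: G_def M_cost_def)
  have xyV: "x \<in> verts G" "y \<in> verts G" by (auto simp: G_def)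
  note G' = transport_pathD[OF G]
  have keys: "Poly_Mapping.keys (Poly_Mapping.single x (m + d)) \<subseteq> verts G"
    "Poly_Mapping.keys (c + Poly_Mapping.single y d) \<subseteq> verts G"
    using xyV G'(4) Poly_Mapping.keys_add[of c "Poly_Mapping.single y d"] by (auto split: if_splits)
  show ?thesis
  proof (cases "x = y")
    case True
    have "transport_path X (Poly_Mapping.single x (m + d)) (c + Poly_Mapping.single y d) G"
      using G keys unfolding transport_path_def
      by (auto simp: True lookup_add lookup_single when_def)
    then show ?thesis using M True by auto
  next
    case False
    let ?e = "(x, y)"
    \<comment> \<open>\<open>weight G\<close> is arbitrary off \<open>edges G\<close>, so a new edge
      has to start from 0.\<close>
    define w' where "w' = (\<lambda>e. (if e \<in> edges G then weight G e else 0) + (if e = ?e then d else 0))"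
    define H where "H = \<lparr>verts = verts G, edges = insert ?e (edges G), weight = w'\<rparr>"
    have sums: "(\<Sum>e | e \<in> insert ?e (edges G) \<and> g e = z. w' e) =
      (\<Sum>e | e \<in> edges G \<and> g e = z. weight G e) + (if g ?e = z then d else 0)"
      for g :: "'a \<times> 'a \<Rightarrow> 'a" and z
    proof -
      let ?F = "{e. e \<in> insert ?e (edges G) \<and> g e = z}"
      have fin: "finite ?F" using G'(6) by auto
      have "(\<Sum>e\<in>?F. w' e) = (\<Sum>e\<in>?F. if e \<in> edges G then weight G e else 0) +
          (\<Sum>e\<in>?F. if e = ?e then d else 0)"
        unfolding w'_def by (rule sum.distrib)
      also have "(\<Sum>e\<in>?F. if e \<in> edges G then weight G e else 0) =
          (\<Sum>e | e \<in> edges G \<and> g e = z. weight G e)"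
        by (rule sum.mono_neutral_cong_right) (use fin in auto)
      also have "(\<Sum>e\<in>?F. if e = ?e then d else 0) = (if g ?e = z then d else 0)"
        using fin by (simp add: sum.delta)
      finally show ?thesis .
    qed
    \<comment> \<open>A path from \<open>y\<close> back to \<open>x\<close> would end with an edge
      into the source.\<close>
    have "(y, x) \<notin> (edges G)\<^sup>*"
      using False single_source_no_edge_into_source[OF G c] by (auto elim: rtranclE)
    then have acyc: "acyclic (insert ?e (edges G))"
      using G'(7) by (simp add: acyclic_insert)
    have H: "transport_path X (Poly_Mapping.single x (m + d)) (c + Poly_Mapping.single y d) H"
      unfolding transport_path_def H_def
    proof (simp only: wgraph.simps sums, intro conjI ballI)
      show "0 < w' e" if "e \<in> insert ?e (edges G)" for e
        using that G'(8)[of e] d by (auto simp: w'_def)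
      show "(\<Sum>e | e \<in> edges G \<and> fst e = z. weight G e) + (if fst ?e = z then d else 0) =
          (\<Sum>e | e \<in> edges G \<and> snd e = z. weight G e) + (if snd ?e = z then d else 0)
          + Poly_Mapping.lookup (Poly_Mapping.single x (m + d)) z
          - Poly_Mapping.lookup (c + Poly_Mapping.single y d) z" if "z \<in> verts G" for z
        using G'(9)[OF that] False by (auto simp: lookup_add lookup_single when_def)
    qed (use G' keys xyV acyc in auto)
    have "M_cost p H = (\<Sum>e\<in>insert ?e (edges G). w' e powr p * dist (fst e) (snd e))"
      by (simp add: M_cost_def H_def)
    also have "\<dots> \<le> (\<Sum>e\<in>insert ?e (edges G).
        (if e \<in> edges G then weight G e powr p * dist (fst e) (snd e) else 0) +
        (if e = ?e then d powr p * dist x y else 0))"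
    proof (rule sum_mono)
      fix e assume "e \<in> insert ?e (edges G)"
      have "(weight G e + d) powr p * dist x y \<le>
          weight G e powr p * dist x y + d powr p * dist x y" if "e \<in> edges G"
        using powr_add_le[OF p, of "weight G e" d] G'(8)[OF that] d
        by (simp add: mult_right_mono flip: distrib_right)
      then show "w' e powr p * dist (fst e) (snd e) \<le>
        (if e \<in> edges G then weight G e powr p * dist (fst e) (snd e) else 0) +
        (if e = ?e then d powr p * dist x y else 0)"
        by (auto simp: w'_def)
    qed
    also have "\<dots> = M_cost p G + d powr p * dist x y"
    proof -
      have "(\<Sum>e\<in>insert ?e (edges G).
          if e \<in> edges G then weight G e powr p * dist (fst e) (snd e) else 0) = M_cost p G"
        unfolding M_cost_def by (rule sum.mono_neutral_cong_right) (use G'(6) in auto)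
      moreover have "(\<Sum>e\<in>insert ?e (edges G). if e = ?e then d powr p * dist x y else 0) =
          d powr p * dist x y"
        using G'(6) by (subst sum.delta) auto
      ultimately show ?thesis by (simp only: sum.distrib)
    qed
    finally show ?thesis using H M by auto
  qed
qed

section \<open>The optimal cost when one atom changes\<close>

lemma M_cost_nonneg: "0 \<le> M_cost p G"
  unfolding M_cost_def by (intro sum_nonneg) auto

lemma bdd_below_M_cost: "bdd_below (M_cost p ` A)"
  by (rule bdd_belowI2[of _ 0]) (rule M_cost_nonneg)

text \<open>Atoms are attached to \<open>x\<close> one at a time. This supplies the nonempty set of
  paths that arguing with the infimum in \<open>d_cost\<close> requires.\<close>

lemma transport_path_exists:
  fixes y :: "'i \<Rightarrow> 'a::metric_space"
  assumes "finite J" "\<And>i. i \<in> J \<Longrightarrow> 0 < n i" "\<And>i. i \<in> J \<Longrightarrow> y i \<in> X" "x \<in> X"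
  shows "\<exists>G. transport_path X (Poly_Mapping.single x (\<Sum>i\<in>J. n i))
    (\<Sum>i\<in>J. Poly_Mapping.single (y i) (n i)) G"
  using assms
proof (induction J)
  case empty
  show ?case
    by (rule exI[of _ "\<lparr>verts = {}, edges = {}, weight = \<lambda>_. 0\<rparr>"]) (simp add: transport_path_def acyclic_def)
next
  case (insert i J)
  then obtain G where G: "transport_path X (Poly_Mapping.single x (\<Sum>i\<in>J. n i))
    (\<Sum>i\<in>J. Poly_Mapping.single (y i) (n i)) G" by auto
  have "0 \<le> Poly_Mapping.lookup (\<Sum>i\<in>J. Poly_Mapping.single (y i) (n i)) v" for v
    using insert by (auto simp: lookup_sum lookup_single when_def less_imp_le intro!: sum_nonneg)
  \<comment> \<open>Any exponent in the unit interval would do, since existence does not depend on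
    the cost.\<close>
  from transport_path_add_atom[of 1, OF _ _ G this, of "n i" "y i"] insert
  show ?case by (auto simp: add.commute)
qed

text \<open>Attainment of the infimum is avoided: each path for the old measures yields a cheaper
  one for the new, and with the saving moved to the left the claim is a lower bound for an infimum.
  \<open>G\<close> shows that this infimum is over a nonempty set.\<close>

lemma d_cost_remove_atom:
  fixes x y :: "'a::metric_space"
  assumes p: "0 \<le> p" "p \<le> 1"
    and "transport_path X (Poly_Mapping.single x m) c G"
    and c: "\<And>v. 0 \<le> Poly_Mapping.lookup c v" and d: "0 \<le> d" "d \<le> Poly_Mapping.lookup c y" "d \<le> m"
  shows "d_cost p X (Poly_Mapping.single x (m - d)) (c - Poly_Mapping.single y d) \<le>
    d_cost p X (Poly_Mapping.single x m) c - (m powr p - (m - d) powr p) * dist x y" (is "?l \<le> ?r - ?k")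
proof -
  have "?l + ?k \<le> ?r"
    unfolding d_cost_def[of _ _ "Poly_Mapping.single x m"]
  proof (rule cINF_greatest)
    fix H assume "H \<in> {G. transport_path X (Poly_Mapping.single x m) c G}"
    then obtain H' where H': "transport_path X (Poly_Mapping.single x (m - d)) (c - Poly_Mapping.single y d) H'"
      "M_cost p H' + ?k \<le> M_cost p H"
      using transport_path_remove_atom[OF p _ c d] by blast
    have "?l \<le> M_cost p H'"
      unfolding d_cost_def by (rule cINF_lower[OF bdd_below_M_cost]) (use H' in simp)
    then show "?l + ?k \<le> M_cost p H" using H'(2) by simp
  qed (use assms(3) in auto)
  then show ?thesis by simp
qed

lemma d_cost_add_atom:
  fixes x y :: "'a::metric_space"
  assumes p: "0 \<le> p" "p \<le> 1"
    and "transport_path X (Poly_Mapping.single x m) c G"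
    and c: "\<And>v. 0 \<le> Poly_Mapping.lookup c v" and d: "0 < d" and xy: "x \<in> X" "y \<in> X"
  shows "d_cost p X (Poly_Mapping.single x (m + d)) (c + Poly_Mapping.single y d) \<le>
    d_cost p X (Poly_Mapping.single x m) c + d powr p * dist x y" (is "?l \<le> ?r + ?k")
proof -
  have "?l - ?k \<le> ?r"
    unfolding d_cost_def[of _ _ "Poly_Mapping.single x m"]
  proof (rule cINF_greatest)
    fix H assume "H \<in> {G. transport_path X (Poly_Mapping.single x m) c G}"
    then obtain H' where H': "transport_path X (Poly_Mapping.single x (m + d)) (c + Poly_Mapping.single y d) H'"
      "M_cost p H' \<le> M_cost p H + ?k"
      using transport_path_add_atom[OF p _ c d xy] by blast
    have "?l \<le> M_cost p H'"
      unfolding d_cost_def by (rule cINF_lower[OF bdd_below_M_cost]) (use H' in simp)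
    then show "?l - ?k \<le> M_cost p H" using H'(2) by simp
  qed (use assms(3) in auto)
  then show ?thesis by simp
qed

section \<open>Masses, \<open>rho\<close> and the exchange inequality\<close>

lemma lookup_b_part:
  "Poly_Mapping.lookup (b_part l y n S i) v = (\<Sum>q\<in>fibre l S i. if y q = v then n q else 0)"
  by (simp add: b_part_def lookup_sum lookup_single when_def)

lemma finite_fibre [simp]: "finite (fibre l S i)"
  by (simp add: fibre_def)

text \<open>Points \<open>y q\<close> may coincide, so the masses are regrouped by swapping the sums
  over atoms and indices.\<close>

lemma mass_b_part: "mass (b_part l y n S i) = (\<Sum>q\<in>fibre l S i. n q)"
proof -
  let ?b = "b_part l y n S i"
  have sub: "Poly_Mapping.keys ?b \<subseteq> y ` fibre l S i"
    by (auto simp: in_keys_iff lookup_b_part elim: contrapos_np intro!: sum.neutral)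
  have "mass ?b = (\<Sum>v\<in>y ` fibre l S i. Poly_Mapping.lookup ?b v)"
    unfolding mass_def by (rule sum.mono_neutral_left[OF _ sub]) (auto simp: in_keys_iff)
  also have "\<dots> = (\<Sum>q\<in>fibre l S i. \<Sum>v\<in>y ` fibre l S i. if y q = v then n q else 0)"
    unfolding lookup_b_part by (rule sum.swap)
  also have "\<dots> = (\<Sum>q\<in>fibre l S i. n q)"
    by (rule sum.cong) auto
  finally show ?thesis .
qed

text \<open>\<open>rho\<close> is the drop caused by removing \<open>e\<close> from
  \<open>m\<close>, in units of \<open>e powr p\<close>. For \<open>p = 0\<close> and
  \<open>m = e\<close> the right side is 1 because \<open>0 powr 0 = 0\<close>, in accordance with
  the separate clause of \<open>rho\<close>.\<close>

lemma rho_powr: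
  assumes "0 < e" "e \<le> m"
  shows "rho p m e * e powr p = m powr p - (m - e) powr p"
proof (cases "p = 0")
  case True
  then show ?thesis using assms by (auto simp: rho_def)
next
  case False
  have "m / e - 1 = (m - e) / e" using assms by (simp add: field_simps)
  then show ?thesis
    using False assms by (simp add: rho_def powr_divide left_diff_distrib)
qed

text \<open>Moving \<open>j\<close> to \<open>r\<close> must not lower the total cost, so the saving
  at \<open>S j\<close> is at most the extra cost at \<open>r\<close>; dividing by
  \<open>n j powr p\<close> gives the bound.\<close>

lemma optimal_assignment_exchange:
  fixes X :: "'a::metric_space set"
  assumes p: "0 \<le> p" "p \<le> 1"
    and x: "x ` {1..k} \<subseteq> X" and y: "y ` {1..l} \<subseteq> X" and n: "\<And>i. i \<in> {1..l} \<Longrightarrow> 0 < n i"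
    and opt: "optimal_assignment p X k l x y n S"
    and j: "j \<in> {1..l}" and r: "r \<in> {1..k}" "r \<noteq> S j"
  shows "rho p (mass (b_part l y n S (S j))) (n j) * dist (x (S j)) (y j) \<le> dist (x r) (y j)"
    and "n j \<le> mass (b_part l y n S (S j))"
proof -
  let ?s = "S j"
  let ?m = "\<lambda>i. \<Sum>q\<in>fibre l S i. n q"
  let ?b = "b_part l y n S"
  let ?d = "\<lambda>T i. d_cost p X (a_part l x n T i) (b_part l y n T i)"
  have S: "S \<in> Maps l k" using opt by (simp add: optimal_assignment_def)
  then have s: "?s \<in> {1..k}" using j by (auto simp: Maps_def)
  have fib: "q \<in> {1..l}" if "q \<in> fibre l S i" for q i
    using that by (simp add: fibre_def)
  have jf: "j \<in> fibre l S ?s" using j by (simp add: fibre_def)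
  have nj: "0 < n j" using n j .
  have nf: "0 \<le> n q" if "q \<in> fibre l S i" for q i
    using n[OF fib[OF that]] by (rule less_imp_le)
  have b0: "0 \<le> Poly_Mapping.lookup (?b i) v" for i v
    unfolding lookup_b_part using nf by (intro sum_nonneg) auto
  have ex: "\<exists>G. transport_path X (Poly_Mapping.single (x i) (?m i)) (?b i) G" if "i \<in> {1..k}" for i
    unfolding b_part_def
  proof (rule transport_path_exists)
    show "0 < n q" if "q \<in> fibre l S i" for q
      using n fib[OF that] .
    show "y q \<in> X" if "q \<in> fibre l S i" for q
      using y fib[OF that] by blast
  qed (use x that in auto)
  have njm: "n j \<le> ?m ?s"
    by (rule member_le_sum[OF jf]) (use nf in auto)
  then show "n j \<le> mass (?b ?s)" by (simp add: mass_b_part)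
  \<comment> \<open>The atom at \<open>y j\<close> may collect several indices, so this is only an
    inequality.\<close>
  have njb: "n j \<le> Poly_Mapping.lookup (?b ?s) (y j)"
  proof -
    have "(if y j = y j then n j else 0) \<le> (\<Sum>q\<in>fibre l S ?s. if y q = y j then n q else 0)"
      by (rule member_le_sum[OF jf]) (use nf in auto)
    then show ?thesis by (simp add: lookup_b_part)
  qed
  define T where "T = S(j := r)"
  have T: "T \<in> Maps l k"
    using S r j by (auto simp: T_def Maps_def PiE_def extensional_def)
  have Ts: "fibre l S ?s = insert j (fibre l T ?s)" "j \<notin> fibre l T ?s"
    using r j by (auto simp: T_def fibre_def)
  have Tr: "fibre l T r = insert j (fibre l S r)" "j \<notin> fibre l S r"
    using r j by (auto simp: T_def fibre_def)
  have Ti: "fibre l T i = fibre l S i" if "i \<noteq> ?s" "i \<noteq> r" for i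
    using that by (auto simp: T_def fibre_def)
  have ds: "?d T ?s \<le> ?d S ?s - ((?m ?s) powr p - (?m ?s - n j) powr p) * dist (x ?s) (y j)"
  proof -
    obtain G where G: "transport_path X (Poly_Mapping.single (x ?s) (?m ?s)) (?b ?s) G"
      using ex[OF s] by blast
    have "a_part l x n T ?s = Poly_Mapping.single (x ?s) (?m ?s - n j)"
      "b_part l y n T ?s = ?b ?s - Poly_Mapping.single (y j) (n j)"
      using Ts by (simp_all add: a_part_def b_part_def)
    then show ?thesis
      using d_cost_remove_atom[OF p G b0 _ njb njm] nj by (simp add: a_part_def)
  qed
  have xX: "x r \<in> X" and yX: "y j \<in> X" using x y r j by blast+
  have dr: "?d T r \<le> ?d S r + n j powr p * dist (x r) (y j)"
  proof -
    obtain G where G: "transport_path X (Poly_Mapping.single (x r) (?m r)) (?b r) G"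
      using ex[OF r(1)] by blast
    have "a_part l x n T r = Poly_Mapping.single (x r) (?m r + n j)"
      "b_part l y n T r = ?b r + Poly_Mapping.single (y j) (n j)"
      using Tr by (simp_all add: a_part_def b_part_def add.commute)
    then show ?thesis
      using d_cost_add_atom[OF p G b0 nj xX yX] by (simp add: a_part_def)
  qed
  \<comment> \<open>Only the two summands split off here differ between \<open>S\<close> and
    \<open>T\<close>.\<close>
  have split: "E_cost p X k l x y n U = ?d U ?s + ?d U r + (\<Sum>i\<in>{1..k} - {?s} - {r}. ?d U i)" for U
  proof -
    have "E_cost p X k l x y n U = ?d U ?s + (\<Sum>i\<in>{1..k} - {?s}. ?d U i)"
      unfolding E_cost_def by (rule sum.remove) (use s in auto)
    also have "(\<Sum>i\<in>{1..k} - {?s}. ?d U i) = ?d U r + (\<Sum>i\<in>{1..k} - {?s} - {r}. ?d U i)"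
      by (rule sum.remove) (use r in auto)
    finally show ?thesis by simp
  qed
  have "(\<Sum>i\<in>{1..k} - {?s} - {r}. ?d T i) = (\<Sum>i\<in>{1..k} - {?s} - {r}. ?d S i)"
    by (rule sum.cong) (auto simp: a_part_def b_part_def Ti)
  moreover have "E_cost p X k l x y n S \<le> E_cost p X k l x y n T"
    using opt T by (simp add: optimal_assignment_def)
  ultimately have "((?m ?s) powr p - (?m ?s - n j) powr p) * dist (x ?s) (y j) \<le>
      n j powr p * dist (x r) (y j)"
    using ds dr unfolding split by linarith
  then have "n j powr p * (rho p (?m ?s) (n j) * dist (x ?s) (y j)) \<le> n j powr p * dist (x r) (y j)"
    unfolding rho_powr[OF nj njm, symmetric] by (simp add: mult_ac)
  then show "rho p (mass (?b ?s)) (n j) * dist (x ?s) (y j) \<le> dist (x r) (y j)"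
    using nj by (simp add: mass_b_part)
qed

theorem theorem2:
  fixes X :: "(real ^ 'm) set"
    and x y :: "nat \<Rightarrow> real ^ 'm"
    and n :: "nat \<Rightarrow> real"
    and k l j s :: nat
    and \<alpha> :: real
    and S :: "nat \<Rightarrow> nat"
  assumes "compact X" and "convex X"
    and "inj_on x {1..k}" and "x ` {1..k} \<subseteq> X"
    and "y ` {1..l} \<subseteq> X"
    and "\<forall>i\<in>{1..l}. n i > 0" and "(\<Sum>i\<in>{1..l}. n i) = 1"
    and "0 \<le> \<alpha>" and "\<alpha> < 1"
    and "optimal_assignment \<alpha> X k l x y n S"
    and "j \<in> {1..l}" and "s \<in> {1..k}"
  shows "(mass (b_part l y n S s) \<ge> n j \<and>
          y j \<in> {z. (INF i\<in>{1..k} - {s}. ereal (norm (z - x i)))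
                      < ereal (rho \<alpha> (mass (b_part l y n S s)) (n j) * norm (z - x s))}
          \<longrightarrow> S j \<noteq> s)
       \<and> (y j \<in> {z. \<forall>i\<in>{1..k}. i \<noteq> s \<and> mass (b_part l y n S i) \<ge> n j \<longrightarrow>
                      norm (z - x s) < rho \<alpha> (mass (b_part l y n S i)) (n j) * norm (z - x i)}
          \<longrightarrow> S j = s)"
proof -
  note exchange = optimal_assignment_exchange[OF assms(8) less_imp_le[OF assms(9)] assms(4,5)
      assms(6)[rule_format] assms(10,11)]
  show ?thesis
  proof (intro conjI impI notI)
    assume near: "mass (b_part l y n S s) \<ge> n j \<and>
        y j \<in> {z. (INF i\<in>{1..k} - {s}. ereal (norm (z - x i)))
          < ereal (rho \<alpha> (mass (b_part l y n S s)) (n j) * norm (z - x s))}"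
      and Sj: "S j = s"
    \<comment> \<open>An infimum strictly below a bound has a member below it. Over the empty index
      set the infimum in \<open>ereal\<close> is infinite, so the assumption then fails.\<close>
    from near obtain i where i: "i \<in> {1..k} - {s}"
      "norm (y j - x i) < rho \<alpha> (mass (b_part l y n S s)) (n j) * norm (y j - x s)"
      unfolding mem_Collect_eq INF_less_iff less_ereal.simps by blast
    then show False
      using exchange(1)[of i] Sj by (auto simp: dist_norm norm_minus_commute)
  next
    assume near: "y j \<in> {z. \<forall>i\<in>{1..k}. i \<noteq> s \<and> mass (b_part l y n S i) \<ge> n j \<longrightarrow>
        norm (z - x s) < rho \<alpha> (mass (b_part l y n S i)) (n j) * norm (z - x i)}"
    show "S j = s"
    proof (rule ccontr)
      assume ne: "S j \<noteq> s"
      have "S j \<in> {1..k}"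
        using assms(10,11) by (auto simp: optimal_assignment_def Maps_def)
      \<comment> \<open>The exchange is with \<open>s\<close>, and \<open>near\<close> is read at
        the index \<open>S j\<close>; its mass condition is the second conclusion of
        \<open>exchange\<close>.\<close>
      then show False
        using near ne exchange[of s] assms(12) by (force simp: dist_norm norm_minus_commute)
    qed
  qed
qed

end
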